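(* Let $X\subseteq\mathbb{R}^m$, $f:X\to\mathbb{R}^d$ with $f(X)\subseteq[f^L,f^U]$, and let $a\in\mathbb{R}^{d\times(n+1)}$ with $f_i^L=a_{i0}<\cdots<a_{in}=f_i^U$ for each $i\in\{1,\dots,d\}$. Let $W\subseteq\mathbb{R}^{m+d}$ be a convex set containing the graph $\{(x,f(x)):x\in X\}$; denote its points by $(x,f)$. Let $s=(s_{ij}):W\to\mathbb{R}^{d\times(n+1)}$ be a vector of convex functions such that $s(W)\subseteq Q$ and $s_{in}(x,f)=f_i$ for every $i\in\{1,\dots,d\}$ and $(x,f)\in W$. Suppose $\phi$ is supermodular over $[f^L,f^U]$ and convex in each argument when the others are fixed. Define $$R=\Bigl\{(x,f,\mu)\Bigm|\exists\, s\in\mathbb{R}^{d\times(n+1)}:\ \mu\le\min_{\omega\in\Omega}\hat{\mathcal{B}}^\omega(\phi)(s;a),\ s(x,f)\le s,\ (x,f)\in W\Bigr\},$$ $$R_+=\Bigl\{(x,f,\mu)\Bigm|\mu\le\min_{\omega\in\Omega}\Bigl[\phi\bigl(\Pi(a;p^0)\bigr)+\sum_{i=1}^d\mathrm{conc}_W\bigl(\mathcal{B}_i^\omega(\phi)\circ s_i\bigr)\bigl((x,f);a\bigr)\Bigr],\ (x,f)\in W\Bigr\}.$$ Then $R$ and $R_+$ are convex sets and $$\bigl\{(x,f,\mu)\bigm|\mu\le\phi(f),\ (x,f)\in W\bigr\}\subseteq R_+\subseteq R.$$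
   Context: $[f^L,f^U]=\prod_i[f_i^L,f_i^U]$. Supermodular: $\phi(x'\vee x'')+\phi(x'\wedge x'')\ge\phi(x')+\phi(x'')$ with componentwise max/min. $Q=\prod_{i=1}^dQ_i$, where $Q_i\subset\mathbb{R}^{n+1}$ is the simplex with vertices $v_{ij}=(a_{i0},\dots,a_{i,j-1},a_{ij},\dots,a_{ij})$, $j=0,\dots,n$ (the $k$-th entry of $v_{ij}$ is $a_{i\min\{k,j\}}$). $\Omega$ is the set of direction vectors in $\{0,\dots,n\}^d$: $\omega\in\{1,\dots,d\}^{dn}$ in which each $i$ occurs exactly $n$ times; $\omega$ defines $p^0=0$, $p^t=p^{t-1}+e_{\omega_t}$ for $t=1,\dots,dn$. For $v=(v_1,\dots,v_d)\in\mathbb{R}^{d\times(n+1)}$ and $p\in\{0,\dots,n\}^d$: $\Pi(v;p)=(v_{1p_1},\dots,v_{dp_d})$. $(s_i,a_{-i})$ is $a$ with block $a_i$ replaced by $s_i$. Define $$\mathcal{B}_i^\omega(\phi)(s_i;a)=\sum_{t:\omega_t=i}\Bigl[\phi\bigl(\Pi((s_i,a_{-i});p^t)\bigr)-\phi\bigl(\Pi((s_i,a_{-i});p^{t-1})\bigr)\Bigr],$$ $$\hat{\mathcal{B}}^\omega(\phi)(s;a)=\phi\bigl(\Pi(a;p^0)\bigr)+\sum_{i=1}^d\sum_{t:\omega_t=i}\frac{\phi(\Pi(a;p^t))-\phi(\Pi(a;p^{t-1}))}{a_{ip^t_i}-a_{ip^{t-1}_i}}\bigl(s_{ip^t_i}-s_{ip^{t-1}_i}\bigr).$$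 $(\mathcal{B}_i^\omega(\phi)\circ s_i)((x,f);a)=\mathcal{B}_i^\omega(\phi)(s_i(x,f);a)$, and $\mathrm{conc}_W(g)$ is the concave envelope of $g$ over $W$ (the smallest concave function on $W$ majorizing $g$). Inequalities between vectors are componentwise. *)

theory Defs
  imports "HOL-Analysis.Analysis"
begin

text \<open>
  A real matrix of size \<open>d \<times> (n + 1)\<close> is a function of type \<^typ>\<open>'d \<Rightarrow> nat \<Rightarrow> real\<close> of which only the
  columns \<open>0, \<dots>, n\<close> are ever used; columns beyond \<open>n\<close> are left unconstrained.
\<close>

definition supermodular_on :: "'a::lattice set \<Rightarrow> ('a \<Rightarrow> real) \<Rightarrow> bool" where
  "supermodular_on S \<phi> \<longleftrightarrow>
     (\<forall>x\<in>S. \<forall>y\<in>S. \<phi> (sup x y) + \<phi> (inf x y) \<ge> \<phi> x + \<phi> y)"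

definition convex_in_each_argument ::
    "real^'d \<Rightarrow> real^'d \<Rightarrow> (real^'d \<Rightarrow> real) \<Rightarrow> bool" where
  "convex_in_each_argument l u \<phi> \<longleftrightarrow>
     (\<forall>x\<in>{l..u}. \<forall>i. convex_on {l $ i..u $ i} (\<lambda>r. \<phi> (\<chi> k. if k = i then r else x $ k)))"

definition is_concave_envelope :: "'a::real_vector set \<Rightarrow> ('a \<Rightarrow> real) \<Rightarrow> ('a \<Rightarrow> real) \<Rightarrow> bool" where
  "is_concave_envelope W g h \<longleftrightarrow>
     concave_on W h \<and> (\<forall>w\<in>W. g w \<le> h w) \<and>
     (\<forall>k. concave_on W k \<and> (\<forall>w\<in>W. g w \<le> k w) \<longrightarrow> (\<forall>w\<in>W. h w \<le> k w))"

text \<open>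
  The envelope is unique on \<open>W\<close>, and it exists as a real-valued function as soon as \<open>g\<close> has
  some real-valued concave majorant on \<open>W\<close>; values outside \<open>W\<close> are arbitrary.
\<close>

definition conc :: "'a::real_vector set \<Rightarrow> ('a \<Rightarrow> real) \<Rightarrow> 'a \<Rightarrow> real" where
  "conc W g = (SOME h. is_concave_envelope W g h)"

lemma is_concave_envelope_unique:
  assumes "is_concave_envelope W g h" "is_concave_envelope W g k" "w \<in> W"
  shows "h w = k w"
  using assms unfolding is_concave_envelope_def by (meson order_antisym)

lemma is_concave_envelope_conc:
  fixes W :: "'a::real_vector set"
  assumes "concave_on W k" and "\<forall>w\<in>W. g w \<le> k w"
  shows "is_concave_envelope W g (conc W g)"
proof -
  define M where "M = {h. concave_on W h \<and> (\<forall>w\<in>W. g w \<le> h w)}"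
  define e where "e = (\<lambda>w. INF h\<in>M. h w)"
  have kM: "k \<in> M" using assms by (simp add: M_def)
  have bdd: "bdd_below ((\<lambda>h. h w) ` M)" if "w \<in> W" for w
    using that by (intro bdd_belowI[of _ "g w"]) (auto simp: M_def)
  have le: "e w \<le> h w" if "h \<in> M" "w \<in> W" for h w
    unfolding e_def using bdd[OF that(2)] that(1) by (rule cINF_lower)
  have ge: "g w \<le> e w" if "w \<in> W" for w
    unfolding e_def using kM that by (intro cINF_greatest) (auto simp: M_def)
  have cW: "convex W" using assms(1) by (simp add: concave_on_def convex_on_def)
  have "u * e x + v * e y \<le> e (u *\<^sub>R x + v *\<^sub>R y)"
    if "x \<in> W" "y \<in> W" "0 \<le> u" "0 \<le> v" "u + v = 1" for x y u v
  proof -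
    have "u * e x + v * e y \<le> h (u *\<^sub>R x + v *\<^sub>R y)" if "h \<in> M" for h
    proof -
      have "u * e x + v * e y \<le> u * h x + v * h y"
        using le[OF that] \<open>x \<in> W\<close> \<open>y \<in> W\<close> \<open>0 \<le> u\<close> \<open>0 \<le> v\<close>
        by (intro add_mono mult_left_mono) auto
      also have "\<dots> \<le> h (u *\<^sub>R x + v *\<^sub>R y)"
        using that \<open>x \<in> W\<close> \<open>y \<in> W\<close> \<open>0 \<le> u\<close> \<open>0 \<le> v\<close> \<open>u + v = 1\<close>
        by (simp add: M_def concave_on_iff)
      finally show ?thesis .
    qed
    then show ?thesis
      using kM by (subst (3) e_def) (auto intro!: cINF_greatest)
  qed
  then have "concave_on W e" using cW by (simp add: concave_on_iff)
  then have "is_concave_envelope W g e"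
    using ge le by (auto simp: is_concave_envelope_def M_def)
  then show ?thesis
    unfolding conc_def by (rule someI[where P = "is_concave_envelope W g"])
qed

text \<open>
  \<open>simplex_vertex a i j k\<close> is the \<open>k\<close>-th entry of \<open>v\<^sub>i\<^sub>j\<close>, and \<open>simplex_Q n a i\<close> is the set of convex
  combinations of \<open>v\<^sub>i\<^sub>0, \<dots>, v\<^sub>i\<^sub>n\<close> (\<^typ>\<open>nat \<Rightarrow> real\<close> carries no vector space structure, so
  \<^const>\<open>convex\<close> \<^const>\<open>hull\<close> is not available).
\<close>

definition simplex_vertex :: "('d \<Rightarrow> nat \<Rightarrow> real) \<Rightarrow> 'd \<Rightarrow> nat \<Rightarrow> nat \<Rightarrow> real" where
  "simplex_vertex a i j k = a i (min k j)"

definition simplex_Q :: "nat \<Rightarrow> ('d \<Rightarrow> nat \<Rightarrow> real) \<Rightarrow> 'd \<Rightarrow> (nat \<Rightarrow> real) set" where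
  "simplex_Q n a i =
     {z. \<exists>c. (\<forall>j\<le>n. c j \<ge> 0) \<and> (\<Sum>j\<le>n. c j) = 1 \<and>
             (\<forall>k\<le>n. z k = (\<Sum>j\<le>n. c j * simplex_vertex a i j k))}"

definition product_Q :: "nat \<Rightarrow> ('d \<Rightarrow> nat \<Rightarrow> real) \<Rightarrow> ('d \<Rightarrow> nat \<Rightarrow> real) set" where
  "product_Q n a = {z. \<forall>i. z i \<in> simplex_Q n a i}"

definition direction_vectors :: "nat \<Rightarrow> ('d::finite) list set" where
  "direction_vectors n = {\<omega>. length \<omega> = CARD('d) * n \<and> (\<forall>i. count_list \<omega> i = n)}"

text \<open>
  Lists are indexed from \<open>0\<close>, direction vectors from \<open>1\<close>: \<open>\<omega>\<^sub>t\<close> is \<open>\<omega> ! (t - 1)\<close>.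
\<close>

primrec grid_point :: "'d list \<Rightarrow> nat \<Rightarrow> 'd \<Rightarrow> nat" where
  "grid_point \<omega> 0 = (\<lambda>i. 0)"
| "grid_point \<omega> (Suc t) = (\<lambda>i. grid_point \<omega> t i + (if i = \<omega> ! t then 1 else 0))"

definition steps :: "'d list \<Rightarrow> 'd \<Rightarrow> nat set" where
  "steps \<omega> i = {t \<in> {1..length \<omega>}. \<omega> ! (t - 1) = i}"

definition Pi_sel :: "('d::finite \<Rightarrow> nat \<Rightarrow> real) \<Rightarrow> ('d \<Rightarrow> nat) \<Rightarrow> real^'d" where
  "Pi_sel v p = (\<chi> i. v i (p i))"

definition B_fun ::
    "'d::finite list \<Rightarrow> (real^'d \<Rightarrow> real) \<Rightarrow> 'd \<Rightarrow> (nat \<Rightarrow> real) \<Rightarrow> ('d \<Rightarrow> nat \<Rightarrow> real) \<Rightarrow> real" where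
  "B_fun \<omega> \<phi> i si a =
     (\<Sum>t\<in>steps \<omega> i. \<phi> (Pi_sel (a(i := si)) (grid_point \<omega> t))
                   - \<phi> (Pi_sel (a(i := si)) (grid_point \<omega> (t - 1))))"

definition B_hat ::
    "'d::finite list \<Rightarrow> (real^'d \<Rightarrow> real) \<Rightarrow> ('d \<Rightarrow> nat \<Rightarrow> real) \<Rightarrow> ('d \<Rightarrow> nat \<Rightarrow> real) \<Rightarrow> real" where
  "B_hat \<omega> \<phi> s a =
     \<phi> (Pi_sel a (grid_point \<omega> 0)) +
     (\<Sum>i\<in>UNIV. \<Sum>t\<in>steps \<omega> i.
        (\<phi> (Pi_sel a (grid_point \<omega> t)) - \<phi> (Pi_sel a (grid_point \<omega> (t - 1))))
          / (a i (grid_point \<omega> t i) - a i (grid_point \<omega> (t - 1) i))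
          * (s i (grid_point \<omega> t i) - s i (grid_point \<omega> (t - 1) i)))"

definition R_set ::
    "nat \<Rightarrow> (real^'d \<Rightarrow> real) \<Rightarrow> ('d::finite \<Rightarrow> nat \<Rightarrow> real) \<Rightarrow> ((real^'m) \<times> (real^'d)) set
      \<Rightarrow> ((real^'m) \<times> (real^'d) \<Rightarrow> 'd \<Rightarrow> nat \<Rightarrow> real) \<Rightarrow> ((real^'m) \<times> (real^'d) \<times> real) set" where
  "R_set n \<phi> a W s =
     {(x, y, \<mu>). \<exists>s'. \<mu> \<le> (MIN \<omega>\<in>direction_vectors n. B_hat \<omega> \<phi> s' a) \<and>
                       (\<forall>i. \<forall>j\<le>n. s (x, y) i j \<le> s' i j) \<and> (x, y) \<in> W}"

definition R_plus ::
    "nat \<Rightarrow> (real^'d \<Rightarrow> real) \<Rightarrow> ('d::finite \<Rightarrow> nat \<Rightarrow> real) \<Rightarrow> ((real^'m) \<times> (real^'d)) set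
      \<Rightarrow> ((real^'m) \<times> (real^'d) \<Rightarrow> 'd \<Rightarrow> nat \<Rightarrow> real) \<Rightarrow> ((real^'m) \<times> (real^'d) \<times> real) set" where
  "R_plus n \<phi> a W s =
     {(x, y, \<mu>). \<mu> \<le> (MIN \<omega>\<in>direction_vectors n.
                         \<phi> (Pi_sel a (grid_point \<omega> 0)) +
                         (\<Sum>i\<in>UNIV. conc W (\<lambda>w. B_fun \<omega> \<phi> i (s w i) a) (x, y))) \<and>
                  (x, y) \<in> W}"

end

theory Submission
  imports Defs
begin

text \<open>
  The slopes of \<open>\<phi>\<close> along the edges of the grid path in a fixed direction \<open>i\<close> increase: convexity
  of \<open>\<phi>\<close> in its \<open>i\<close>-th argument handles the moving \<open>i\<close>-th coordinate, supermodularity the other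
  ones. Summation by parts therefore writes the \<open>i\<close>-th summand of \<open>B_hat\<close> as an affine function of
  \<open>s\<^sub>i\<^sub>0\<close> and \<open>s\<^sub>i\<^sub>n\<close> minus a nonnegative combination of the convex functions \<open>s\<^sub>i\<^sub>j\<close>, so it is concave
  on \<open>W\<close>. On the simplex it majorizes \<open>B_fun\<close>, because moving both endpoints of an interval to
  the right increases the secant slope of a convex function; hence it also majorizes the concave
  envelope, which gives \<open>R_plus \<subseteq> R_set\<close>. Finally, \<open>\<phi>(f)\<close> telescopes along the grid path of \<open>s\<close>, and
  replacing the inactive coordinates of each increment by the larger \<open>a\<close> increases it by
  supermodularity.
\<close>

section \<open>Secant slopes of convex functions of one real variable\<close>

text \<open>The right endpoint moves first, then the left one: passing through the interval from
  \<open>p\<close> to \<open>q'\<close> leaves one three-point slope inequality for each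
  move.\<close>

lemma convex_on_slope_mono:
  fixes \<psi> :: "real \<Rightarrow> real"
  assumes cvx: "convex_on {l..u} \<psi>"
    and "l \<le> p" "p < q" "p \<le> p'" "q \<le> q'" "p' < q'" "q' \<le> u"
  shows "(\<psi> q - \<psi> p) / (q - p) \<le> (\<psi> q' - \<psi> p') / (q' - p')"
proof -
  have swap: "(\<psi> x - \<psi> y) / (x - y) = (\<psi> y - \<psi> x) / (y - x)" for x y
    by (metis minus_diff_eq minus_divide_divide)
  have "(\<psi> q - \<psi> p) / (q - p) \<le> (\<psi> q' - \<psi> p) / (q' - p)"
  proof (cases "q = q'")
    case False
    then show ?thesis
      using convex_on_slope_le(1)[OF cvx, of p q' q] assms
      by (simp add: swap[of p])
  qed simp
  also have "\<dots> \<le> (\<psi> q' - \<psi> p') / (q' - p')"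
  proof (cases "p = p'")
    case False
    then show ?thesis
      using convex_on_slope_le(2)[OF cvx, of p q' p'] assms
      by (simp add: swap[of p] swap[of p'])
  qed simp
  finally show ?thesis .
qed

text \<open>Clearing the denominator \<open>q - p\<close> admits \<open>p = q\<close>: consecutive
  entries of a point of the simplex may coincide, while those of \<open>a\<close> strictly
  increase.\<close>

lemma convex_on_secant_le:
  fixes \<psi> :: "real \<Rightarrow> real"
  assumes cvx: "convex_on {l..u} \<psi>"
    and "l \<le> p" "p \<le> q" "p \<le> p'" "q \<le> q'" "p' < q'" "q' \<le> u"
  shows "\<psi> q - \<psi> p \<le> (\<psi> q' - \<psi> p') / (q' - p') * (q - p)"
proof (cases "p = q")
  case False
  then have "p < q" using assms by simp
  then have "(\<psi> q - \<psi> p) / (q - p) \<le> (\<psi> q' - \<psi> p') / (q' - p')"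
    using assms by (intro convex_on_slope_mono[OF cvx])
  then show ?thesis using \<open>p < q\<close> by (simp add: pos_divide_le_eq)
qed simp

lemma convex_on_cong_on:
  assumes "\<And>x. x \<in> S \<Longrightarrow> f x = g x"
  shows "convex_on S f \<longleftrightarrow> convex_on S g"
  using assms by (auto simp: convex_on_def convexD)

lemma is_concave_envelope_le:
  assumes "is_concave_envelope W g h" "concave_on W k" "\<And>w. w \<in> W \<Longrightarrow> g w \<le> k w" "w \<in> W"
  shows "h w \<le> k w"
  using assms unfolding is_concave_envelope_def by blast

section \<open>Replacing one coordinate; increasing differences\<close>

definition vec_upd :: "real^'d \<Rightarrow> 'd \<Rightarrow> real \<Rightarrow> real^'d" where
  "vec_upd x i r = (\<chi> k. if k = i then r else x $ k)"

lemma vec_upd_nth [simp]: "vec_upd x i r $ k = (if k = i then r else x $ k)"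
  by (simp add: vec_upd_def)

lemma vec_upd_in_Icc:
  assumes "x \<in> {l..u}" "l $ i \<le> r" "r \<le> u $ i"
  shows "vec_upd x i r \<in> {l..u}"
  using assms by (auto simp: less_eq_vec_def)

text \<open>Supermodularity is applied to \<open>vec_upd x i r'\<close> and
  \<open>vec_upd y i r\<close>, whose supremum and infimum are the other two points.\<close>

lemma supermodular_on_increment_mono:
  fixes \<phi> :: "real^'d \<Rightarrow> real"
  assumes "supermodular_on {l..u} \<phi>" and x: "x \<in> {l..u}" and y: "y \<in> {l..u}"
    and xy: "\<And>k. k \<noteq> i \<Longrightarrow> x $ k \<le> y $ k"
    and r: "l $ i \<le> r" "r \<le> r'" "r' \<le> u $ i"
  shows "\<phi> (vec_upd x i r') - \<phi> (vec_upd x i r) \<le> \<phi> (vec_upd y i r') - \<phi> (vec_upd y i r)"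
proof -
  have "vec_upd x i r' \<in> {l..u}" "vec_upd y i r \<in> {l..u}"
    using x y r by (intro vec_upd_in_Icc; simp)+
  moreover have "sup (vec_upd x i r') (vec_upd y i r) = vec_upd y i r'"
    using r xy by (auto simp: vec_eq_iff sup_vec_def sup_real_def max_def intro: antisym)
  moreover have "inf (vec_upd x i r') (vec_upd y i r) = vec_upd x i r"
    using r xy by (auto simp: vec_eq_iff inf_vec_def inf_real_def min_def intro: antisym)
  ultimately show ?thesis
    using assms(1) unfolding supermodular_on_def by fastforce
qed

lemma convex_in_each_argument_vec_upd:
  assumes "convex_in_each_argument l u \<phi>" "x \<in> {l..u}"
  shows "convex_on {l $ i..u $ i} (\<lambda>r. \<phi> (vec_upd x i r))"
  using assms by (simp add: convex_in_each_argument_def vec_upd_def)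

section \<open>Grid paths of direction vectors\<close>

lemma grid_point_eq_count_list:
  "t \<le> length \<omega> \<Longrightarrow> grid_point \<omega> t i = count_list (take t \<omega>) i"
  by (induction t) (auto simp: take_Suc_conv_app_nth)

lemma grid_point_mono: "t \<le> t' \<Longrightarrow> grid_point \<omega> t i \<le> grid_point \<omega> t' i"
  by (induction t' rule: dec_induct) auto

lemma grid_point_length:
  "\<omega> \<in> direction_vectors n \<Longrightarrow> grid_point \<omega> (length \<omega>) i = n"
  by (simp add: grid_point_eq_count_list direction_vectors_def)

lemma grid_point_le:
  "\<omega> \<in> direction_vectors n \<Longrightarrow> t \<le> length \<omega> \<Longrightarrow> grid_point \<omega> t i \<le> n"
  by (metis grid_point_length grid_point_mono)

lemma finite_direction_vectors: "finite (direction_vectors n :: 'd::finite list set)"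
proof (rule finite_subset)
  show "direction_vectors n \<subseteq> {\<omega>. set \<omega> \<subseteq> (UNIV :: 'd set) \<and> length \<omega> = CARD('d) * n}"
    by (auto simp: direction_vectors_def)
qed (simp only: finite_lists_length_eq finite)

text \<open>Listing every index \<open>n\<close> times in a row gives a direction vector. With
  finiteness this makes the \<open>MIN\<close> in \<open>R_set\<close> and \<open>R_plus\<close> a
  genuine minimum.\<close>

lemma direction_vectors_nonempty: "(direction_vectors n :: 'd::finite list set) \<noteq> {}"
proof -
  obtain ds :: "'d list" where ds: "set ds = UNIV" "distinct ds"
    using finite_distinct_list[of "UNIV :: 'd set"] by auto
  have replicate: "count_list (replicate n x) i = (if x = i then n else 0)" for x i :: 'd
    by (induction n) auto
  have "count_list (concat (map (replicate n) es)) i = (if i \<in> set es then n else 0)"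
    if "distinct es" for es and i :: 'd
    using that by (induction es) (auto simp: replicate)
  moreover have "length (concat (map (replicate n) es)) = length es * n" for es :: "'d list"
    by (induction es) auto
  moreover have "length ds = CARD('d)"
    using ds distinct_card by force
  ultimately have "concat (map (replicate n) ds) \<in> direction_vectors n"
    using ds by (simp add: direction_vectors_def)
  then show ?thesis by blast
qed

lemma steps_eq_image: "steps \<omega> i = Suc ` {t. t < length \<omega> \<and> \<omega> ! t = i}"
proof
  show "steps \<omega> i \<subseteq> Suc ` {t. t < length \<omega> \<and> \<omega> ! t = i}"
  proof
    fix t assume "t \<in> steps \<omega> i"
    then show "t \<in> Suc ` {t. t < length \<omega> \<and> \<omega> ! t = i}"
      by (cases t) (auto simp: steps_def)
  qed
qed (auto simp: steps_def)

lemma sum_steps: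
  "(\<Sum>t\<in>steps \<omega> i. F t) = (\<Sum>t<length \<omega>. if \<omega> ! t = i then F (Suc t) else 0)"
  by (auto simp: steps_eq_image sum.reindex sum.If_cases intro!: sum.cong)

text \<open>Each position \<open>t\<close> belongs to exactly one direction,
  \<open>\<omega> ! t\<close>; the resulting single sum along the path is the form that
  telescopes.\<close>

lemma sum_sum_steps:
  fixes F :: "'d::finite \<Rightarrow> nat \<Rightarrow> 'b::comm_monoid_add"
  shows "(\<Sum>i\<in>UNIV. \<Sum>t\<in>steps \<omega> i. F i t) = (\<Sum>t<length \<omega>. F (\<omega> ! t) (Suc t))"
  unfolding sum_steps by (subst sum.swap) simp

section \<open>Selected points along a path and the linearized increments\<close>

lemma Pi_sel_fun_upd: "Pi_sel (v(i := z)) p = vec_upd (Pi_sel v p) i (z (p i))"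
  by (auto simp: Pi_sel_def vec_eq_iff)

lemma Pi_sel_grid_point_Suc:
  "Pi_sel v (grid_point \<omega> (Suc t)) =
     vec_upd (Pi_sel v (grid_point \<omega> t)) (\<omega> ! t) (v (\<omega> ! t) (Suc (grid_point \<omega> t (\<omega> ! t))))"
  by (auto simp: Pi_sel_def vec_eq_iff)

lemma vec_upd_Pi_sel_same: "vec_upd (Pi_sel v p) i (v i (p i)) = Pi_sel v p"
  by (auto simp: Pi_sel_def vec_eq_iff)

definition edge_slope ::
    "(real^'d \<Rightarrow> real) \<Rightarrow> ('d::finite \<Rightarrow> nat \<Rightarrow> real) \<Rightarrow> 'd list \<Rightarrow> 'd \<Rightarrow> nat \<Rightarrow> real" where
  "edge_slope \<phi> a \<omega> i t =
     (\<phi> (Pi_sel a (grid_point \<omega> t)) - \<phi> (Pi_sel a (grid_point \<omega> (t - 1))))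
       / (a i (grid_point \<omega> t i) - a i (grid_point \<omega> (t - 1) i))"

text \<open>The \<open>i\<close>-th summand of \<open>B_hat\<close> as a linear functional of the
  row \<open>z\<close>, with slopes fixed by \<open>a\<close>.\<close>

definition B_lin ::
    "(real^'d \<Rightarrow> real) \<Rightarrow> ('d::finite \<Rightarrow> nat \<Rightarrow> real) \<Rightarrow> 'd list \<Rightarrow> 'd \<Rightarrow> (nat \<Rightarrow> real) \<Rightarrow> real" where
  "B_lin \<phi> a \<omega> i z =
     (\<Sum>t\<in>steps \<omega> i. edge_slope \<phi> a \<omega> i t * (z (grid_point \<omega> t i) - z (grid_point \<omega> (t - 1) i)))"

lemma B_hat_eq_B_lin:
  "B_hat \<omega> \<phi> s a = \<phi> (Pi_sel a (grid_point \<omega> 0)) + (\<Sum>i\<in>UNIV. B_lin \<phi> a \<omega> i (s i))"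
  by (simp add: B_hat_def B_lin_def edge_slope_def)

lemma B_lin_combination:
  "B_lin \<phi> a \<omega> i (\<lambda>j. u * z j + v * z' j) = u * B_lin \<phi> a \<omega> i z + v * B_lin \<phi> a \<omega> i z'"
  unfolding B_lin_def sum_distrib_left sum.distrib[symmetric]
  by (intro sum.cong) (auto simp: algebra_simps)

lemma B_hat_combination:
  assumes "u + v = 1"
  shows "B_hat \<omega> \<phi> (\<lambda>i j. u * s i j + v * s' i j) a = u * B_hat \<omega> \<phi> s a + v * B_hat \<omega> \<phi> s' a"
proof -
  have "u * c + v * c = c" for c :: real
    using assms by (metis distrib_right mult_1)
  then show ?thesis
    unfolding B_hat_eq_B_lin B_lin_combination
    by (simp add: sum.distrib sum_distrib_left[symmetric] distrib_left)
qed

section \<open>Bounds on the grid and on points of the simplex\<close>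

locale supermodular_grid =
  fixes n :: nat and a :: "'d::finite \<Rightarrow> nat \<Rightarrow> real" and l u :: "real^'d"
    and \<phi> :: "real^'d \<Rightarrow> real"
  assumes a_first: "a i 0 = l $ i"
    and a_last: "a i n = u $ i"
    and a_incr: "j < n \<Longrightarrow> a i j < a i (Suc j)"
    and supermodular: "supermodular_on {l..u} \<phi>"
    and convex_arg: "convex_in_each_argument l u \<phi>"
begin

lemma a_mono: "j \<le> k \<Longrightarrow> k \<le> n \<Longrightarrow> a i j \<le> a i k"
proof (induction k rule: dec_induct)
  case (step k)
  then show ?case using a_incr[of k i] by simp
qed simp

lemma a_in_range:
  assumes "j \<le> n" shows "l $ i \<le> a i j" "a i j \<le> u $ i"
  using a_mono[of 0 j i] a_mono[of j n i] assms by (simp_all add: a_first a_last)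

lemma simplex_Q_first:
  assumes "z \<in> simplex_Q n a i" shows "z 0 = a i 0"
proof -
  obtain c where "(\<Sum>j\<le>n. c j) = 1" "z 0 = (\<Sum>j\<le>n. c j * simplex_vertex a i j 0)"
    using assms unfolding simplex_Q_def by blast
  then show ?thesis
    by (simp add: simplex_vertex_def sum_distrib_right[symmetric])
qed

text \<open>Every vertex is nondecreasing in its column index, and the weights are
  nonnegative.\<close>

lemma simplex_Q_mono:
  assumes "z \<in> simplex_Q n a i" "j \<le> k" "k \<le> n"
  shows "z j \<le> z k"
proof -
  obtain c where c: "\<forall>j\<le>n. c j \<ge> 0" "\<forall>k\<le>n. z k = (\<Sum>j\<le>n. c j * simplex_vertex a i j k)"
    using assms(1) unfolding simplex_Q_def by blast
  have "z j = (\<Sum>m\<le>n. c m * simplex_vertex a i m j)" using c assms by simp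
  also have "\<dots> \<le> (\<Sum>m\<le>n. c m * simplex_vertex a i m k)"
    using c(1) assms(2,3) unfolding simplex_vertex_def
    by (intro sum_mono mult_left_mono a_mono) auto
  also have "\<dots> = z k" using c assms by simp
  finally show ?thesis .
qed

lemma simplex_Q_le:
  assumes "z \<in> simplex_Q n a i" "k \<le> n"
  shows "z k \<le> a i k"
proof -
  obtain c where c: "\<forall>j\<le>n. c j \<ge> 0" "(\<Sum>j\<le>n. c j) = 1"
    "\<forall>k\<le>n. z k = (\<Sum>j\<le>n. c j * simplex_vertex a i j k)"
    using assms(1) unfolding simplex_Q_def by blast
  have "z k = (\<Sum>m\<le>n. c m * simplex_vertex a i m k)" using c assms by simp
  also have "\<dots> \<le> (\<Sum>m\<le>n. c m * a i k)"
    using c(1) assms(2) unfolding simplex_vertex_def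
    by (intro sum_mono mult_left_mono a_mono) auto
  also have "\<dots> = a i k" using c(2) by (simp add: sum_distrib_right[symmetric])
  finally show ?thesis .
qed

lemma simplex_Q_in_range:
  assumes "z \<in> simplex_Q n a i" "k \<le> n"
  shows "l $ i \<le> z k" "z k \<le> u $ i"
  using simplex_Q_first[OF assms(1)] simplex_Q_mono[OF assms(1), of 0 k]
    simplex_Q_le[OF assms] a_in_range[OF assms(2), of i] assms(2) a_first[of i] by auto

lemma Pi_sel_a_in_range: "(\<And>i. p i \<le> n) \<Longrightarrow> Pi_sel a p \<in> {l..u}"
  by (auto simp: Pi_sel_def less_eq_vec_def a_in_range)

lemma Pi_sel_in_range: "s \<in> product_Q n a \<Longrightarrow> (\<And>i. p i \<le> n) \<Longrightarrow> Pi_sel s p \<in> {l..u}"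
  by (auto simp: Pi_sel_def less_eq_vec_def product_Q_def simplex_Q_in_range)

section \<open>Estimates along a fixed direction vector\<close>

context
  fixes \<omega> :: "'d list"
  assumes \<omega>: "\<omega> \<in> direction_vectors n"
begin

text \<open>The next step raises this coordinate by 1 without passing \<open>n\<close>, so its
  successor is still a column of \<open>a\<close>.\<close>

lemma grid_point_less:
  assumes "t < length \<omega>" "\<omega> ! t = i"
  shows "grid_point \<omega> t i < n"
  using grid_point_le[OF \<omega>, of "Suc t" i] assms by simp

lemma edge_slope_Suc:
  assumes "\<omega> ! t = i" and "j = grid_point \<omega> t i"
  defines "\<psi> \<equiv> \<lambda>r. \<phi> (vec_upd (Pi_sel a (grid_point \<omega> t)) i r)"
  shows "edge_slope \<phi> a \<omega> i (Suc t) = (\<psi> (a i (Suc j)) - \<psi> (a i j)) / (a i (Suc j) - a i j)"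
  using assms Pi_sel_grid_point_Suc[of a \<omega> t]
  by (simp add: edge_slope_def vec_upd_Pi_sel_same del: grid_point.simps) simp

text \<open>The comparison passes through an auxiliary slope over the earlier interval, from
  \<open>a i j\<close> to \<open>a i (Suc j)\<close>, but with the other coordinates of the later
  point \<open>x'\<close>.\<close>

lemma edge_slope_mono:
  assumes "t < t'" "t' < length \<omega>" "\<omega> ! t = i" "\<omega> ! t' = i"
  shows "edge_slope \<phi> a \<omega> i (Suc t) \<le> edge_slope \<phi> a \<omega> i (Suc t')"
proof -
  define j j' where "j = grid_point \<omega> t i" and "j' = grid_point \<omega> t' i"
  define x x' where "x = Pi_sel a (grid_point \<omega> t)" and "x' = Pi_sel a (grid_point \<omega> t')"
  have jn: "j < n" "j' < n"
    using assms by (simp_all add: j_def j'_def grid_point_less)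
  have jj': "j \<le> j'" using assms by (simp add: j_def j'_def grid_point_mono)
  have x: "x \<in> {l..u}" "x' \<in> {l..u}"
    unfolding x_def x'_def using assms by (intro Pi_sel_a_in_range grid_point_le[OF \<omega>]; simp)+
  have xx': "x $ k \<le> x' $ k" for k
    unfolding x_def x'_def Pi_sel_def using assms
    by (simp add: a_mono grid_point_mono grid_point_le[OF \<omega>])
  have "edge_slope \<phi> a \<omega> i (Suc t) =
      (\<phi> (vec_upd x i (a i (Suc j))) - \<phi> (vec_upd x i (a i j))) / (a i (Suc j) - a i j)"
    using edge_slope_Suc[OF assms(3) j_def] by (simp add: x_def)
  also have "\<dots> \<le> (\<phi> (vec_upd x' i (a i (Suc j))) - \<phi> (vec_upd x' i (a i j))) / (a i (Suc j) - a i j)"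
    using jn a_incr[of j i] a_in_range[of _ i] xx'
    by (intro divide_right_mono supermodular_on_increment_mono[OF supermodular x]) auto
  also have "\<dots> \<le> (\<phi> (vec_upd x' i (a i (Suc j'))) - \<phi> (vec_upd x' i (a i j'))) / (a i (Suc j') - a i j')"
    using jn jj' a_incr[of _ i] a_in_range[of _ i] a_mono[of _ _ i]
    by (intro convex_on_slope_mono[OF convex_in_each_argument_vec_upd[OF convex_arg x(2)]]) auto
  also have "\<dots> = edge_slope \<phi> a \<omega> i (Suc t')"
    using edge_slope_Suc[OF assms(4) j'_def] by (simp add: x'_def)
  finally show ?thesis .
qed

text \<open>Termwise, both increments run along the same line through \<open>x\<close>, and the
  endpoints \<open>z j\<close>, \<open>z (Suc j)\<close> lie weakly to the left of
  \<open>a i j\<close>, \<open>a i (Suc j)\<close>.\<close>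

lemma B_fun_le_B_lin:
  assumes z: "z \<in> simplex_Q n a i"
  shows "B_fun \<omega> \<phi> i z a \<le> B_lin \<phi> a \<omega> i z"
proof -
  have "\<phi> (Pi_sel (a(i := z)) (grid_point \<omega> (Suc t))) - \<phi> (Pi_sel (a(i := z)) (grid_point \<omega> t))
      \<le> edge_slope \<phi> a \<omega> i (Suc t) * (z (grid_point \<omega> (Suc t) i) - z (grid_point \<omega> t i))"
    if t: "t < length \<omega>" "\<omega> ! t = i" for t
  proof -
    define j where "j = grid_point \<omega> t i"
    define x where "x = Pi_sel a (grid_point \<omega> t)"
    have jn: "j < n" using t by (simp add: j_def grid_point_less)
    have x: "x \<in> {l..u}"
      unfolding x_def using t by (intro Pi_sel_a_in_range grid_point_le[OF \<omega>]; simp)+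
    have upd: "vec_upd (vec_upd y i r) i r' = vec_upd y i r'" for y :: "real^'d" and r r'
      by (simp add: vec_eq_iff)
    have Suc_j: "grid_point \<omega> (Suc t) i = Suc j" using t by (simp add: j_def)
    have "Pi_sel (a(i := z)) (grid_point \<omega> t) = vec_upd x i (z j)"
      by (simp add: Pi_sel_fun_upd x_def j_def)
    moreover have "Pi_sel (a(i := z)) (grid_point \<omega> (Suc t)) = vec_upd x i (z (Suc j))"
      using t Pi_sel_grid_point_Suc[of a \<omega> t]
      by (simp only: Pi_sel_fun_upd x_def Suc_j upd)
    moreover have "edge_slope \<phi> a \<omega> i (Suc t) =
      (\<phi> (vec_upd x i (a i (Suc j))) - \<phi> (vec_upd x i (a i j))) / (a i (Suc j) - a i j)"
      using edge_slope_Suc[OF t(2) j_def] by (simp add: x_def)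
    moreover have "\<phi> (vec_upd x i (z (Suc j))) - \<phi> (vec_upd x i (z j)) \<le>
      (\<phi> (vec_upd x i (a i (Suc j))) - \<phi> (vec_upd x i (a i j))) / (a i (Suc j) - a i j)
        * (z (Suc j) - z j)"
      using jn a_incr[of _ i] a_in_range[of _ i] simplex_Q_in_range[OF z] simplex_Q_le[OF z]
        simplex_Q_mono[OF z]
      by (intro convex_on_secant_le[OF convex_in_each_argument_vec_upd[OF convex_arg x]]) auto
    ultimately show ?thesis by (simp only: Suc_j flip: j_def)
  qed
  then show ?thesis
    unfolding B_fun_def B_lin_def steps_eq_image
    by (intro sum_mono) auto
qed

lemma phi_le_sum_B_fun:
  assumes s: "s \<in> product_Q n a"
  shows "\<phi> (Pi_sel s (\<lambda>_. n)) \<le>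
    \<phi> (Pi_sel a (grid_point \<omega> 0)) + (\<Sum>i\<in>UNIV. B_fun \<omega> \<phi> i (s i) a)"
proof -
  define g where "g = grid_point \<omega>"
  have sQ: "s i \<in> simplex_Q n a i" for i
    using s by (simp add: product_Q_def)
  have first: "Pi_sel a (g 0) = Pi_sel s (g 0)"
    using simplex_Q_first[OF sQ] by (simp add: Pi_sel_def g_def)
  have last: "g (length \<omega>) = (\<lambda>_. n)"
    using grid_point_length[OF \<omega>] by (auto simp: g_def)
  have "\<phi> (Pi_sel s (g (Suc t))) - \<phi> (Pi_sel s (g t)) \<le>
      \<phi> (Pi_sel (a(\<omega> ! t := s (\<omega> ! t))) (g (Suc t))) - \<phi> (Pi_sel (a(\<omega> ! t := s (\<omega> ! t))) (g t))"
    if t: "t < length \<omega>" for t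
  proof -
    define i where "i = \<omega> ! t"
    define j where "j = g t i"
    define v where "v = a(i := s i)"
    have jn: "j < n" using t by (simp add: j_def i_def g_def grid_point_less)
    have gn: "g t k \<le> n" for k
      using t by (simp add: g_def grid_point_le[OF \<omega>])
    have s_t: "Pi_sel s (g t) \<in> {l..u}" and "Pi_sel a (g t) \<in> {l..u}"
      using Pi_sel_in_range[OF s gn] Pi_sel_a_in_range[OF gn] .
    then have v_t: "Pi_sel v (g t) \<in> {l..u}"
      using simplex_Q_in_range[OF sQ, of j i] jn
      by (simp only: v_def Pi_sel_fun_upd j_def) (intro vec_upd_in_Icc; simp)
    have Suc_t: "Pi_sel w (g (Suc t)) = vec_upd (Pi_sel w (g t)) i (w i (Suc j))" for w
      using Pi_sel_grid_point_Suc[of w \<omega> t] by (simp add: g_def i_def j_def)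
    have same: "Pi_sel w (g t) = vec_upd (Pi_sel w (g t)) i (w i j)" for w
      by (simp add: j_def vec_upd_Pi_sel_same)
    \<comment> \<open>Coordinate \<open>i\<close> runs over the same interval on both sides; the
      others rise from entries of \<open>s\<close> to entries of \<open>a\<close>, by
      \<open>simplex_Q_le\<close>.\<close>
    have "\<phi> (vec_upd (Pi_sel s (g t)) i (s i (Suc j))) - \<phi> (vec_upd (Pi_sel s (g t)) i (s i j))
        \<le> \<phi> (vec_upd (Pi_sel v (g t)) i (s i (Suc j))) - \<phi> (vec_upd (Pi_sel v (g t)) i (s i j))"
      using jn gn simplex_Q_in_range[OF sQ] simplex_Q_mono[OF sQ] simplex_Q_le[OF sQ]
      by (intro supermodular_on_increment_mono[OF supermodular s_t v_t]) (auto simp: Pi_sel_def v_def)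
    moreover have "v i = s i" by (simp add: v_def)
    ultimately show ?thesis
      by (metis Suc_t same i_def v_def)
  qed
  then have "(\<Sum>t<length \<omega>. \<phi> (Pi_sel s (g (Suc t))) - \<phi> (Pi_sel s (g t))) \<le>
      (\<Sum>i\<in>UNIV. B_fun \<omega> \<phi> i (s i) a)"
    unfolding B_fun_def sum_sum_steps by (intro sum_mono) (auto simp: g_def simp del: grid_point.simps)
  then show ?thesis
    using first last sum_lessThan_telescope[of "\<lambda>t. \<phi> (Pi_sel s (g t))" "length \<omega>"]
    by (simp add: g_def del: grid_point.simps)
qed

text \<open>A column strictly between 0 and \<open>n\<close> carries a difference of consecutive
  slopes, nonpositive by \<open>edge_slope_mono\<close>. Column 0 is constant on \<open>W\<close>,
  and column \<open>n\<close> is both convex and concave, so their coefficients may have any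
  sign.\<close>

lemma concave_on_B_lin:
  fixes W :: "'w::real_vector set"
  assumes "convex W"
    and cvx: "\<And>j. j \<le> n \<Longrightarrow> convex_on W (\<lambda>w. \<sigma> w j)"
    and first: "\<And>w. w \<in> W \<Longrightarrow> \<sigma> w 0 = c0"
    and last: "concave_on W (\<lambda>w. \<sigma> w n)"
  shows "concave_on W (\<lambda>w. B_lin \<phi> a \<omega> i (\<sigma> w))"
proof -
  define \<beta> where "\<beta> t = edge_slope \<phi> a \<omega> i (Suc t)" for t
  define g where "g t = grid_point \<omega> t i" for t
  define S where "S T w = (\<Sum>t<T. if \<omega> ! t = i then \<beta> t * (\<sigma> w (g (Suc t)) - \<sigma> w (g t)) else 0)"
    for T w
  have gn: "g t \<le> n" if "t \<le> length \<omega>" for t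
    using that by (simp add: g_def grid_point_le[OF \<omega>])
  txt \<open>Summation by parts as an induction; the pending last term is weighted by any bound \<open>C\<close> on the
    slopes seen so far.\<close>
  have partial: "concave_on W (\<lambda>w. S T w - C * \<sigma> w (g T))"
    if "T \<le> length \<omega>" "\<And>t. t < T \<Longrightarrow> \<omega> ! t = i \<Longrightarrow> \<beta> t \<le> C" for T C
    using that
  proof (induction T arbitrary: C)
    case 0
    have "convex_on W (\<lambda>w. C * \<sigma> w 0) \<longleftrightarrow> convex_on W (\<lambda>w. C * c0)"
      by (rule convex_on_cong_on) (simp add: first)
    moreover have "convex_on W (\<lambda>w. C * c0)"
      using assms(1) by (simp add: convex_on_const)
    ultimately show ?case by (simp add: S_def g_def concave_on_def)
  next
    case (Suc T)
    show ?case
    proof (cases "\<omega> ! T = i")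
      case True
      \<comment> \<open>The induction hypothesis is used with \<open>\<beta> T\<close> as the bound;
        the new column then enters with weight \<open>\<beta> T - C \<le> 0\<close>.\<close>
      have "concave_on W (\<lambda>w. S T w - \<beta> T * \<sigma> w (g T))"
        using Suc.prems True by (intro Suc.IH) (auto simp: \<beta>_def edge_slope_mono)
      moreover have "convex_on W (\<lambda>w. (C - \<beta> T) * \<sigma> w (g (Suc T)))"
        using Suc.prems True by (intro convex_on_cmul cvx gn) auto
      ultimately have "concave_on W (\<lambda>w. (S T w - \<beta> T * \<sigma> w (g T)) - (C - \<beta> T) * \<sigma> w (g (Suc T)))"
        by (rule concave_on_diff)
      then show ?thesis
        using True by (simp add: S_def algebra_simps)
    next
      case False
      then have "g (Suc T) = g T" by (simp add: g_def)
      moreover have "S (Suc T) w = S T w" for w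
        using False by (simp add: S_def)
      ultimately show ?thesis
        using Suc by simp
    qed
  qed
  \<comment> \<open>A nonnegative upper bound for all slopes; nonnegativity keeps
    \<open>C * \<sigma> w n\<close> concave when it is added back.\<close>
  define C where "C = (\<Sum>t<length \<omega>. \<bar>\<beta> t\<bar>)"
  have "\<beta> t \<le> C" if "t < length \<omega>" for t
    using member_le_sum[of t "{..<length \<omega>}" "\<lambda>t. \<bar>\<beta> t\<bar>"] that unfolding C_def by force
  then have "concave_on W (\<lambda>w. S (length \<omega>) w - C * \<sigma> w (g (length \<omega>)))"
    by (intro partial) auto
  moreover have "g (length \<omega>) = n" by (simp add: g_def grid_point_length[OF \<omega>])
  moreover have "concave_on W (\<lambda>w. C * \<sigma> w n)"
    by (intro concave_on_cmul last) (simp add: C_def sum_nonneg)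
  ultimately have "concave_on W (\<lambda>w. (S (length \<omega>) w - C * \<sigma> w n) + C * \<sigma> w n)"
    by (intro concave_on_add) simp_all
  moreover have "B_lin \<phi> a \<omega> i (\<sigma> w) = S (length \<omega>) w" for w
    unfolding B_lin_def sum_steps S_def
    by (intro sum.cong) (auto simp: g_def \<beta>_def simp del: grid_point.simps)
  ultimately show ?thesis by simp
qed

end

end

section \<open>Convexity of the two sets and the chain of inclusions\<close>

theorem theorem2p2:
  fixes X :: "(real^'m) set"
    and f :: "real^'m \<Rightarrow> real^'d"
    and fL fU :: "real^'d"
    and n :: nat
    and a :: "'d \<Rightarrow> nat \<Rightarrow> real"
    and W :: "((real^'m) \<times> (real^'d)) set"
    and s :: "(real^'m) \<times> (real^'d) \<Rightarrow> 'd \<Rightarrow> nat \<Rightarrow> real"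
    and \<phi> :: "real^'d \<Rightarrow> real"
  assumes f_range: "f ` X \<subseteq> {fL..fU}"
    and a_first: "\<And>i. a i 0 = fL $ i"
    and a_last: "\<And>i. a i n = fU $ i"
    and a_incr: "\<And>i j. j < n \<Longrightarrow> a i j < a i (Suc j)"
    and W_convex: "convex W"
    and W_graph: "(\<lambda>x. (x, f x)) ` X \<subseteq> W"
    and s_convex: "\<And>i j. j \<le> n \<Longrightarrow> convex_on W (\<lambda>w. s w i j)"
    and s_range: "s ` W \<subseteq> product_Q n a"
    and s_last: "\<And>i x y. (x, y) \<in> W \<Longrightarrow> s (x, y) i n = y $ i"
    and \<phi>_supermodular: "supermodular_on {fL..fU} \<phi>"
    and \<phi>_convex: "convex_in_each_argument fL fU \<phi>"
  shows "convex (R_set n \<phi> a W s) \<and>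
         convex (R_plus n \<phi> a W s) \<and>
         {(x, y, \<mu>). \<mu> \<le> \<phi> y \<and> (x, y) \<in> W} \<subseteq> R_plus n \<phi> a W s \<and>
         R_plus n \<phi> a W s \<subseteq> R_set n \<phi> a W s"
proof -
  interpret supermodular_grid n a fL fU \<phi>
    by unfold_locales (use a_first a_last a_incr \<phi>_supermodular \<phi>_convex in auto)
  let ?D = "direction_vectors n :: 'd list set"
  let ?B = "\<lambda>\<omega> i w. B_fun \<omega> \<phi> i (s w i) a"
  let ?P0 = "\<lambda>\<omega>. \<phi> (Pi_sel a (grid_point \<omega> 0))"
  have le_Min: "\<mu> \<le> (MIN \<omega>\<in>?D. F \<omega>) \<longleftrightarrow> (\<forall>\<omega>\<in>?D. \<mu> \<le> F \<omega>)" for \<mu> and F :: "'d list \<Rightarrow> real"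
    by (subst Min_ge_iff) (auto simp: finite_direction_vectors direction_vectors_nonempty)
  have sQ: "s w \<in> product_Q n a" "s w i \<in> simplex_Q n a i" if "w \<in> W" for w i
    using s_range that by (auto simp: product_Q_def)
  have s_n: "s w i n = snd w $ i" if "w \<in> W" for w i
    using s_last[of "fst w" "snd w" i] that by simp
  \<comment> \<open>Column \<open>n\<close> is a coordinate of the point, hence affine on
    \<open>W\<close>.\<close>
  have concave_n: "concave_on W (\<lambda>w. s w i n)" for i
    using W_convex by (auto simp: concave_on_iff s_n convexD)
  have lin: "concave_on W (\<lambda>w. B_lin \<phi> a \<omega> i (s w i))" if "\<omega> \<in> ?D" for \<omega> i
    by (rule concave_on_B_lin[OF that W_convex s_convex simplex_Q_first[OF sQ(2)] concave_n])
  have maj: "?B \<omega> i w \<le> B_lin \<phi> a \<omega> i (s w i)" if "\<omega> \<in> ?D" "w \<in> W" for \<omega> i w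
    using B_fun_le_B_lin that sQ by blast
  \<comment> \<open>\<open>B_lin\<close> composed with \<open>s\<close> is a concave majorant, so
    the envelope exists and the choice in \<open>conc\<close> picks it.\<close>
  have env: "is_concave_envelope W (?B \<omega> i) (conc W (?B \<omega> i))" if "\<omega> \<in> ?D" for \<omega> i
    using maj[OF that] by (intro is_concave_envelope_conc[OF lin[OF that]] ballI)

  \<comment> \<open>\<open>R_set\<close> is a projection of a set that is convex in
    \<open>(x, y, \<mu>, s')\<close>, as \<open>B_hat\<close> is affine in \<open>s'\<close> and
    \<open>s\<close> is convex; so the witnesses are combined with the same weights.\<close>
  have "convex (R_set n \<phi> a W s)"
  proof (rule convexI)
    fix p q :: "(real^'m) \<times> (real^'d) \<times> real" and u v :: real
    assume p: "p \<in> R_set n \<phi> a W s" and q: "q \<in> R_set n \<phi> a W s"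
      and uv: "0 \<le> u" "0 \<le> v" "u + v = 1"
    obtain x y \<mu> where p_eq: "p = (x, y, \<mu>)" by (cases p)
    obtain x' y' \<mu>' where q_eq: "q = (x', y', \<mu>')" by (cases q)
    obtain z where z: "\<And>\<omega>. \<omega> \<in> ?D \<Longrightarrow> \<mu> \<le> B_hat \<omega> \<phi> z a" "\<And>i j. j \<le> n \<Longrightarrow> s (x, y) i j \<le> z i j"
      "(x, y) \<in> W"
      using p by (auto simp: R_set_def p_eq le_Min)
    obtain z' where z': "\<And>\<omega>. \<omega> \<in> ?D \<Longrightarrow> \<mu>' \<le> B_hat \<omega> \<phi> z' a"
      "\<And>i j. j \<le> n \<Longrightarrow> s (x', y') i j \<le> z' i j" "(x', y') \<in> W"
      using q by (auto simp: R_set_def q_eq le_Min)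
    let ?z = "\<lambda>i j. u * z i j + v * z' i j"
    have w: "(u *\<^sub>R x + v *\<^sub>R x', u *\<^sub>R y + v *\<^sub>R y') \<in> W"
      using convexD[OF W_convex z(3) z'(3) uv] by simp
    have "s (u *\<^sub>R x + v *\<^sub>R x', u *\<^sub>R y + v *\<^sub>R y') i j \<le> ?z i j" if "j \<le> n" for i j
    proof -
      have "s (u *\<^sub>R (x, y) + v *\<^sub>R (x', y')) i j \<le> u * s (x, y) i j + v * s (x', y') i j"
        using s_convex[OF that, of i] z(3) z'(3) uv unfolding convex_on_def by blast
      also have "\<dots> \<le> ?z i j"
        using z(2) z'(2) that uv by (intro add_mono mult_left_mono) auto
      finally show ?thesis by simp
    qed
    moreover have "u * \<mu> + v * \<mu>' \<le> B_hat \<omega> \<phi> ?z a" if "\<omega> \<in> ?D" for \<omega>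
      unfolding B_hat_combination[OF uv(3)] using z(1) z'(1) that uv
      by (intro add_mono mult_left_mono) auto
    ultimately show "u *\<^sub>R p + v *\<^sub>R q \<in> R_set n \<phi> a W s"
      using w by (auto simp: R_set_def p_eq q_eq le_Min intro!: exI[of _ ?z])
  qed
  \<comment> \<open>\<open>R_plus\<close> is the intersection of the hypographs over
    \<open>W\<close> of the concave functions \<open>?G \<omega>\<close>.\<close>
  moreover have "convex (R_plus n \<phi> a W s)"
  proof (rule convexI)
    fix p q :: "(real^'m) \<times> (real^'d) \<times> real" and u v :: real
    assume p: "p \<in> R_plus n \<phi> a W s" and q: "q \<in> R_plus n \<phi> a W s"
      and uv: "0 \<le> u" "0 \<le> v" "u + v = 1"
    obtain x y \<mu> where p_eq: "p = (x, y, \<mu>)" by (cases p)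
    obtain x' y' \<mu>' where q_eq: "q = (x', y', \<mu>')" by (cases q)
    let ?G = "\<lambda>\<omega> w. ?P0 \<omega> + (\<Sum>i\<in>UNIV. conc W (?B \<omega> i) w)"
    have w: "(x, y) \<in> W" and \<mu>: "\<And>\<omega>. \<omega> \<in> ?D \<Longrightarrow> \<mu> \<le> ?G \<omega> (x, y)"
      using p by (auto simp: R_plus_def p_eq le_Min)
    have w': "(x', y') \<in> W" and \<mu>': "\<And>\<omega>. \<omega> \<in> ?D \<Longrightarrow> \<mu>' \<le> ?G \<omega> (x', y')"
      using q by (auto simp: R_plus_def q_eq le_Min)
    have w'': "(u *\<^sub>R x + v *\<^sub>R x', u *\<^sub>R y + v *\<^sub>R y') \<in> W"
      using convexD[OF W_convex w w' uv] by simp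
    have "u * \<mu> + v * \<mu>' \<le> ?G \<omega> (u *\<^sub>R x + v *\<^sub>R x', u *\<^sub>R y + v *\<^sub>R y')" if D: "\<omega> \<in> ?D" for \<omega>
    proof -
      have "u * \<mu> + v * \<mu>' \<le> u * ?G \<omega> (x, y) + v * ?G \<omega> (x', y')"
        using \<mu>[OF D] \<mu>'[OF D] uv by (intro add_mono mult_left_mono) auto
      also have "\<dots> = (u + v) * ?P0 \<omega> +
          (\<Sum>i\<in>UNIV. u * conc W (?B \<omega> i) (x, y) + v * conc W (?B \<omega> i) (x', y'))"
        by (simp add: sum.distrib sum_distrib_left algebra_simps del: grid_point.simps)
      also have "\<dots> \<le> (u + v) * ?P0 \<omega> +
          (\<Sum>i\<in>UNIV. conc W (?B \<omega> i) (u *\<^sub>R (x, y) + v *\<^sub>R (x', y')))"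
      proof (intro add_left_mono sum_mono)
        fix i
        have "concave_on W (conc W (?B \<omega> i))"
          using env[OF D] by (simp add: is_concave_envelope_def)
        then show "u * conc W (?B \<omega> i) (x, y) + v * conc W (?B \<omega> i) (x', y') \<le>
            conc W (?B \<omega> i) (u *\<^sub>R (x, y) + v *\<^sub>R (x', y'))"
          using w w' uv unfolding concave_on_iff by blast
      qed
      finally show ?thesis using uv(3) by simp
    qed
    then show "u *\<^sub>R p + v *\<^sub>R q \<in> R_plus n \<phi> a W s"
      using w'' by (simp add: R_plus_def p_eq q_eq le_Min del: grid_point.simps)
  qed
  moreover have "{(x, y, \<mu>). \<mu> \<le> \<phi> y \<and> (x, y) \<in> W} \<subseteq> R_plus n \<phi> a W s"
  proof clarify
    fix x y \<mu> assume \<mu>: "\<mu> \<le> \<phi> y" and w: "(x, y) \<in> W"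
    \<comment> \<open>The path of \<open>s (x, y)\<close> ends at \<open>y\<close> itself, so the
      telescoped bound is a bound on \<open>\<phi> y\<close>.\<close>
    have y: "Pi_sel (s (x, y)) (\<lambda>_. n) = y"
      using s_last[OF w] by (simp add: Pi_sel_def)
    have "\<mu> \<le> ?P0 \<omega> + (\<Sum>i\<in>UNIV. conc W (?B \<omega> i) (x, y))" if D: "\<omega> \<in> ?D" for \<omega>
    proof -
      have "\<mu> \<le> ?P0 \<omega> + (\<Sum>i\<in>UNIV. ?B \<omega> i (x, y))"
        using phi_le_sum_B_fun[OF D sQ(1)[OF w]] \<mu> y by simp
      also have "\<dots> \<le> ?P0 \<omega> + (\<Sum>i\<in>UNIV. conc W (?B \<omega> i) (x, y))"
        using env[OF D] w by (intro add_left_mono sum_mono) (auto simp: is_concave_envelope_def)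
      finally show ?thesis .
    qed
    then show "(x, y, \<mu>) \<in> R_plus n \<phi> a W s"
      using w by (simp add: R_plus_def le_Min del: grid_point.simps)
  qed
  moreover have "R_plus n \<phi> a W s \<subseteq> R_set n \<phi> a W s"
  proof
    fix p assume p: "p \<in> R_plus n \<phi> a W s"
    obtain x y \<mu> where p_eq: "p = (x, y, \<mu>)" by (cases p)
    have w: "(x, y) \<in> W"
      and \<mu>: "\<And>\<omega>. \<omega> \<in> ?D \<Longrightarrow> \<mu> \<le> ?P0 \<omega> + (\<Sum>i\<in>UNIV. conc W (?B \<omega> i) (x, y))"
      using p by (auto simp: R_plus_def p_eq le_Min)
    \<comment> \<open>The witness \<open>s'\<close> is \<open>s (x, y)\<close>; minimality puts each
      envelope below the concave majorant \<open>B_lin\<close>.\<close>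
    have "\<mu> \<le> B_hat \<omega> \<phi> (s (x, y)) a" if D: "\<omega> \<in> ?D" for \<omega>
    proof -
      have "(\<Sum>i\<in>UNIV. conc W (?B \<omega> i) (x, y)) \<le> (\<Sum>i\<in>UNIV. B_lin \<phi> a \<omega> i (s (x, y) i))"
        by (intro sum_mono is_concave_envelope_le[OF env[OF D] lin[OF D] maj[OF D] w])
      then show ?thesis using \<mu>[OF D] by (simp add: B_hat_eq_B_lin)
    qed
    then show "p \<in> R_set n \<phi> a W s"
      using w by (auto simp: R_set_def p_eq le_Min)
  qed
  ultimately show ?thesis by blast
qed

end
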